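(* Let $X$ be a compact Hausdorff space. Suppose there exists a $G_\delta$-set $C\subset X^2$, homeomorphic to $X$, such that for every $x\in X$ there are $a\in C$ and a unique $b\in C$ with $x=\pi_1(a)=\pi_2(b)$ (that is, there is at least one $a\in C$ with $\pi_1(a)=x$ and exactly one $b\in C$ with $\pi_2(b)=x$). Then $X$ is metrizable.
   Context: $\pi_1,\pi_2:X^2\to X$ are the projections onto the first and second coordinates; $X^2$ has the product topology and $C$ the subspace topology. A $G_\delta$-set is a countable intersection of open sets. *)

theory Defs
  imports "HOL-Analysis.Analysis"
begin

end

theory Submission
  imports Defs
begin

text \<open>By compactness the second projection restricts to a homeomorphism from \<open>C\<close> onto \<open>X\<close>, so that
  \<open>C = {(f y, y)}\<close> for a continuous surjection \<open>f\<close>. Hence \<open>C\<close> is the preimage of the diagonal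
  under the surjection \<open>(x, y) \<mapsto> (x, f y)\<close> of \<open>X\<^sup>2\<close>. This map is closed and sends the complement
  of \<open>C\<close>, an \<open>F\<^sub>\<sigma>\<close>-set, onto the complement of the diagonal. So \<open>X\<close> has a \<open>G\<^sub>\<delta>\<close> diagonal, and
  a compact Hausdorff space with this property is metrizable (Sneider): countably many continuous
  real functions separate its points.\<close>

text \<open>Evaluation at all members of \<open>F\<close> is a continuous injection of a compact
  space into a Hausdorff one, hence an embedding, and a countable power of the real line is
  metrizable.\<close>

lemma metrizable_space_countable_separating_family:
  fixes F :: "('a \<Rightarrow> real) set"
  assumes "compact_space X" "countable F"
    and cont: "\<And>f. f \<in> F \<Longrightarrow> continuous_map X euclideanreal f"
    and sep: "\<And>x y. \<lbrakk>x \<in> topspace X; y \<in> topspace X; x \<noteq> y\<rbrakk> \<Longrightarrow> \<exists>f\<in>F. f x \<noteq> f y"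
  shows "metrizable_space X"
proof -
  let ?P = "product_topology (\<lambda>f. euclideanreal) F"
  \<comment> \<open>The restriction to \<open>F\<close> makes \<open>?e x\<close> extensional, as
    the points of \<open>?P\<close> must be.\<close>
  let ?e = "\<lambda>x. \<lambda>f\<in>F. f x"
  have "metrizable_space ?P"
    unfolding metrizable_space_product_topology
    using \<open>countable F\<close> by (auto intro: metrizable_space_euclidean countable_subset)
  moreover have "X homeomorphic_space subtopology ?P (?e ` topspace X)"
  proof (intro embedding_map_imp_homeomorphic_space continuous_imp_embedding_map)
    show "continuous_map X ?P ?e"
      by (auto simp: continuous_map_componentwise cont)
    show "inj_on ?e (topspace X)"
    proof (rule inj_onI)
      fix x y assume "x \<in> topspace X" "y \<in> topspace X" "?e x = ?e y"
      then show "x = y"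
        using sep[of x y] by (metis (no_types, lifting) restrict_apply')
    qed
  qed (use assms in \<open>auto simp: Hausdorff_space_product_topology\<close>)
  ultimately show ?thesis
    using homeomorphic_metrizable_space metrizable_space_subtopology by blast
qed

text \<open>Urysohn functions separate the coordinates of each point of \<open>K\<close>; the pairs
  separated by one function form an open set, so compactness leaves finitely many functions.\<close>

lemma finite_family_separating_compact:
  assumes X: "compact_space X" "Hausdorff_space X"
    and K: "compactin (prod_topology X X) K" and off: "\<And>x. (x, x) \<notin> K"
  obtains F :: "('a \<Rightarrow> real) set" where "finite F"
    "\<And>f. f \<in> F \<Longrightarrow> continuous_map X euclideanreal f"
    "\<And>x y. (x, y) \<in> K \<Longrightarrow> \<exists>f\<in>F. f x \<noteq> f y"
proof -
  let ?C = "{f. continuous_map X euclideanreal f}"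
  define V where
    "V f = {p \<in> topspace (prod_topology X X). f (fst p) - f (snd p) \<in> - {0}}" for f :: "'a \<Rightarrow> real"
  have V_open: "openin (prod_topology X X) (V f)" if "f \<in> ?C" for f
  proof -
    have "continuous_map (prod_topology X X) euclideanreal (\<lambda>p. f (fst p) - f (snd p))"
      using that continuous_map_compose[OF continuous_map_fst, of X euclideanreal f X]
        continuous_map_compose[OF continuous_map_snd, of X euclideanreal f X]
      by (intro continuous_map_diff) (simp_all add: o_def)
    then show ?thesis
      unfolding V_def by (rule openin_continuous_map_preimage) auto
  qed
  have "K \<subseteq> \<Union> (V ` ?C)"
  proof clarify
    fix x y assume xy: "(x, y) \<in> K"
    then have inX: "x \<in> topspace X" "y \<in> topspace X"
      using compactin_subset_topspace[OF K] by auto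
    have "x \<noteq> y" using off xy by blast
    have "closedin X {x}" "closedin X {y}"
      using X inX by (simp_all add: closedin_Hausdorff_sing_eq)
    moreover have "disjnt {x} {y}" using \<open>x \<noteq> y\<close> by simp
    moreover have "normal_space X"
      using X by (simp add: compact_Hausdorff_or_regular_imp_normal_space)
    ultimately obtain f where "continuous_map X euclideanreal f" "f ` {x} \<subseteq> {0}" "f ` {y} \<subseteq> {1::real}"
      using Urysohn_lemma_alt by metis
    then show "(x, y) \<in> \<Union> (V ` ?C)"
      using inX by (auto simp: V_def)
  qed
  moreover have "openin (prod_topology X X) U" if "U \<in> V ` ?C" for U
    using that V_open by blast
  ultimately obtain \<F> where \<F>: "finite \<F>" "\<F> \<subseteq> V ` ?C" "K \<subseteq> \<Union> \<F>"
    using compactinD[OF K, of "V ` ?C"] by metis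
  then obtain F where F: "F \<subseteq> ?C" "finite F" "\<F> = V ` F"
    by (meson finite_subset_image)
  show thesis
  proof (rule that[of F])
    show "\<exists>f\<in>F. f x \<noteq> f y" if xy: "(x, y) \<in> K" for x y
    proof -
      obtain f where "f \<in> F" "(x, y) \<in> V f"
        using xy F(3) \<F>(3) by blast
      then show ?thesis
        by (auto simp: V_def)
    qed
  qed (use F in auto)
qed

text \<open>The complement of the diagonal is a countable union of closed, hence compact, sets
  \<open>K n\<close>. Each yields a finite separating family, and the union of these families is
  countable.\<close>

lemma metrizable_space_gdelta_diagonal:
  assumes X: "compact_space X" "Hausdorff_space X"
    and diag: "gdelta_in (prod_topology X X) ((\<lambda>x. (x, x)) ` topspace X)"
  shows "metrizable_space X"
proof -
  let ?D = "(\<lambda>x. (x, x)) ` topspace X"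
  have "fsigma_in (prod_topology X X) (topspace (prod_topology X X) - ?D)"
    using diag gdelta_in_fsigma_in by blast
  then obtain K :: "nat \<Rightarrow> _" where K: "\<And>n. closedin (prod_topology X X) (K n)"
    "\<Union> (range K) = topspace (prod_topology X X) - ?D"
    unfolding fsigma_in_ascending by blast
  have "\<exists>F. finite F \<and> (\<forall>f\<in>F. continuous_map X euclideanreal f)
      \<and> (\<forall>x y. (x, y) \<in> K n \<longrightarrow> (\<exists>f\<in>F. f x \<noteq> f y))" for n
  proof (rule finite_family_separating_compact[OF X, of "K n"])
    show "compactin (prod_topology X X) (K n)"
      using X K by (simp add: closedin_compact_space compact_space_prod_topology)
    show "(x, x) \<notin> K n" for x
    proof
      assume "(x, x) \<in> K n"
      then have "(x, x) \<in> topspace (prod_topology X X) - ?D"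
        using K(2) by blast
      then show False by auto
    qed
  qed blast
  then obtain F where F: "\<And>n. finite (F n)"
    "\<And>n f. f \<in> F n \<Longrightarrow> continuous_map X euclideanreal f"
    "\<And>n x y. (x, y) \<in> K n \<Longrightarrow> \<exists>f\<in>F n. f x \<noteq> f y"
    by metis
  show ?thesis
  proof (rule metrizable_space_countable_separating_family[of X "\<Union>n. F n"])
    show "countable (\<Union>n. F n)"
      using F(1) by (simp add: countable_finite)
    show "\<exists>f\<in>\<Union>n. F n. f x \<noteq> f y"
      if "x \<in> topspace X" "y \<in> topspace X" "x \<noteq> y" for x y
    proof -
      have "(x, y) \<in> \<Union> (range K)"
        using that by (auto simp: K(2))
      then show ?thesis using F(3) by blast
    qed
  qed (use X F in auto)
qed

lemma fsigma_in_closed_map_image: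
  assumes "closed_map X Y h" "fsigma_in X S"
  shows "fsigma_in Y (h ` S)"
proof -
  obtain K :: "nat \<Rightarrow> _" where "\<And>n. closedin X (K n)" "\<Union> (range K) = S"
    using assms(2) unfolding fsigma_in_ascending by blast
  then have S: "h ` S = \<Union> (range (\<lambda>n. h ` K n))" and "\<And>n. closedin Y (h ` K n)"
    using assms(1) by (auto simp: closed_map_def)
  then have "\<And>n. fsigma_in Y (h ` K n)"
    by (simp add: closed_imp_fsigma_in)
  then show ?thesis
    unfolding S by (intro fsigma_in_Union) auto
qed

theorem proposition5p1:
  fixes X :: "'a topology" and C :: "('a \<times> 'a) set"
  assumes "compact_space X" and "Hausdorff_space X"
    and "gdelta_in (prod_topology X X) C"
    and "subtopology (prod_topology X X) C homeomorphic_space X"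
    and "\<forall>x\<in>topspace X. (\<exists>a\<in>C. fst a = x) \<and> (\<exists>!b. b \<in> C \<and> snd b = x)"
  shows "metrizable_space X"
proof -
  let ?XX = "prod_topology X X"
  let ?S = "subtopology ?XX C"
  let ?D = "(\<lambda>x. (x, x)) ` topspace X"
  have CX: "C \<subseteq> topspace ?XX"
    using assms(3) by (rule gdelta_in_subset)
  then have topS: "topspace ?S = C" by auto
  have "homeomorphic_map ?S X snd"
  proof (rule continuous_imp_homeomorphic_map)
    show "continuous_map ?S X snd"
      by (simp add: continuous_map_from_subtopology continuous_map_snd)
    \<comment> \<open>\<open>C\<close> is not assumed closed; its compactness is inherited from
      \<open>X\<close> through the given homeomorphism.\<close>
    show "compact_space ?S"
      using assms(1,4) homeomorphic_compact_space by blast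
    show "snd ` topspace ?S = topspace X"
      unfolding topS using CX assms(5) by (force simp: image_iff)
    show "inj_on snd (topspace ?S)"
      unfolding topS using CX assms(5) by (intro inj_onI) (metis mem_Times_iff subsetD topspace_prod_topology)
  qed fact
  then obtain g where g: "homeomorphic_maps ?S X snd g"
    using homeomorphic_map_maps by blast
  \<comment> \<open>The inverse \<open>g\<close> of \<open>snd\<close> has the form
    \<open>y \<mapsto> (f y, y)\<close>, so \<open>C\<close> is the graph of \<open>f\<close> with
    its coordinates swapped.\<close>
  define f where "f = fst \<circ> g"
  have "continuous_map X ?XX g"
    using g by (simp add: homeomorphic_maps_def continuous_map_in_subtopology)
  then have f_cont: "continuous_map X X f"
    unfolding f_def by (rule continuous_map_compose) (rule continuous_map_fst)
  have C_iff: "(x, y) \<in> C \<longleftrightarrow> y \<in> topspace X \<and> x = f y" for x y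
  proof
    assume "(x, y) \<in> C"
    then show "y \<in> topspace X \<and> x = f y"
      using g CX unfolding homeomorphic_maps_def topS f_def by force
  next
    assume "y \<in> topspace X \<and> x = f y"
    moreover have "g y \<in> C" "snd (g y) = y" if "y \<in> topspace X"
      using g that topS unfolding homeomorphic_maps_def continuous_map_def by auto
    ultimately show "(x, y) \<in> C"
      unfolding f_def by (metis comp_apply prod.collapse)
  qed
  \<comment> \<open>This is the hypothesis on the first projection, read through
    \<open>C_iff\<close>.\<close>
  have f_surj: "\<exists>y\<in>topspace X. x = f y" if "x \<in> topspace X" for x
    using assms(5) that C_iff by (metis prod.collapse)
  have f_in: "f y \<in> topspace X" if "y \<in> topspace X" for y
    using f_cont that by (auto simp: continuous_map_def)
  let ?h = "\<lambda>p. (fst p, f (snd p))"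
  have "continuous_map ?XX ?XX ?h"
    using f_cont continuous_map_compose[OF continuous_map_snd f_cont, of X]
    by (intro continuous_map_pairedI continuous_map_fst) (simp add: o_def)
  then have "closed_map ?XX ?XX ?h"
    using assms(1,2)
    by (intro continuous_imp_closed_map)
      (auto simp: compact_space_prod_topology Hausdorff_space_prod_topology)
  moreover have "fsigma_in ?XX (topspace ?XX - C)"
    using assms(3) unfolding gdelta_in_fsigma_in by (rule conjunct2)
  ultimately have "fsigma_in ?XX (?h ` (topspace ?XX - C))"
    by (rule fsigma_in_closed_map_image)
  \<comment> \<open>By \<open>C_iff\<close>, \<open>?h p\<close> lies on the diagonal exactly when
    \<open>p\<close> lies in \<open>C\<close>. For the inclusion from right to left, an off-diagonal
    \<open>(x, z)\<close> with \<open>z = f y\<close> is the image of \<open>(x, y)\<close>, which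
    is outside \<open>C\<close> since \<open>x \<noteq> f y\<close>.\<close>
  also have "?h ` (topspace ?XX - C) = topspace ?XX - ?D"
  proof (intro equalityI subsetI)
    fix p assume "p \<in> topspace ?XX - ?D"
    then obtain x z where p: "p = (x, z)" "x \<in> topspace X" "z \<in> topspace X" "x \<noteq> z"
      by auto
    then obtain y where "y \<in> topspace X" "z = f y"
      using f_surj by blast
    then show "p \<in> ?h ` (topspace ?XX - C)"
      using p C_iff by (intro image_eqI[of _ _ "(x, y)"]) auto
  qed (auto simp: C_iff f_in)
  finally have "gdelta_in ?XX ?D"
    by (auto simp: gdelta_in_fsigma_in)
  then show ?thesis
    using assms(1,2) metrizable_space_gdelta_diagonal by blast
qed

end
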